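(* Let $S\subset\mathbb{R}^d$ be a $d$-dimensional simplex all of whose dihedral angles are acute. Then there exists a closed classical billiard trajectory in $S$ with $d+1$ bounces.
   Context: Lengths and angles are Euclidean. The dihedral angles of $S$ are the interior angles between pairs of its facets. For a convex body $K\subset\mathbb{R}^d$ (compact convex set with nonempty interior) and $q\in\partial K$, the cone of outer normals is $N_K(q)=\{n\in\mathbb{R}^d:\langle n,q'-q\rangle\le 0\ \forall q'\in K\}$. A point $q\in\partial K$ is smooth if $N_K(q)$ is a single ray (the support hyperplane at $q$ is unique), and non-smooth otherwise. Closed generalized billiard trajectory in $K$ with $m\ge 2$ bounces: a closed polygonal line $q_1\to q_2\to\dots\to q_m\to q_1$ with $q_i\in\partial K$ (cyclic indexing) such that for every $i$ the point $q_i$ does not belong to the segment $[q_{i-1},q_{i+1}]$ and the bisector of the angle $\angle q_{i-1}q_iq_{i+1}$ is orthogonal to some support hyperplane of $K$ at $q_i$; equivalently, $\frac{q_i-q_{i-1}}{|q_i-q_{i-1}|}-\frac{q_{i+1}-q_i}{|q_{i+1}-q_i|}$ is a nonzero element of $N_K(q_i)$. The trajectory is classical if all its bounce points $q_i$ are smooth points of $\partial K$. *)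

theory Defs
  imports "HOL-Analysis.Analysis"
begin

definition vec_angle :: "'a::euclidean_space \<Rightarrow> 'a \<Rightarrow> real" where
  "vec_angle u v = arccos (u \<bullet> v / (norm u * norm v))"

(* For a ridge R that is a facet of the convex set F: the unit vector parallel to aff F and
   orthogonal to R that points from R into F. The direction space of F has exactly one
   dimension more than that of R, so the vector is unique. *)
definition inward_conormal :: "'a::euclidean_space set \<Rightarrow> 'a set \<Rightarrow> 'a" where
  "inward_conormal F R = (THE u. norm u = 1 \<and>
      u \<in> span {x - y | x y. x \<in> F \<and> y \<in> F} \<and>
      (\<forall>x\<in>R. \<forall>y\<in>R. u \<bullet> (x - y) = 0) \<and>
      (\<forall>x\<in>F. \<forall>r\<in>R. u \<bullet> (x - r) \<ge> 0))"

(* Interior angle at the ridge F \<inter> G of a convex polytope between its facets F and G. *)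
definition dihedral_angle :: "'a::euclidean_space set \<Rightarrow> 'a set \<Rightarrow> real" where
  "dihedral_angle F G =
     vec_angle (inward_conormal F (F \<inter> G)) (inward_conormal G (F \<inter> G))"

(* Any two facets of a simplex of dimension at least 2 meet in a ridge. In dimension 1 the facets
   are two distinct points; there is no ridge, hence no dihedral angle. *)
definition acute_dihedral_angles :: "'a::euclidean_space set \<Rightarrow> bool" where
  "acute_dihedral_angles S \<longleftrightarrow>
     (\<forall>F G. F facet_of S \<and> G facet_of S \<and> F \<noteq> G \<and> F \<inter> G \<noteq> {}
        \<longrightarrow> dihedral_angle F G < pi / 2)"

definition outer_normals :: "'a::euclidean_space set \<Rightarrow> 'a \<Rightarrow> 'a set" where
  "outer_normals K q = {n. \<forall>q'\<in>K. n \<bullet> (q' - q) \<le> 0}"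

definition smooth_point :: "'a::euclidean_space set \<Rightarrow> 'a \<Rightarrow> bool" where
  "smooth_point K q \<longleftrightarrow>
     q \<in> frontier K \<and> (\<exists>n. n \<noteq> 0 \<and> outer_normals K q = {t *\<^sub>R n | t. t \<ge> 0})"

(* The bounce points form an m-periodic sequence over the integers, which encodes the cyclic
   indexing. Since sgn x = x /\<^sub>R norm x, the vector n is the change of unit direction at q i. *)
definition generalized_billiard_trajectory ::
    "'a::euclidean_space set \<Rightarrow> nat \<Rightarrow> (int \<Rightarrow> 'a) \<Rightarrow> bool" where
  "generalized_billiard_trajectory K m q \<longleftrightarrow>
     m \<ge> 2 \<and> (\<forall>i. q (i + int m) = q i) \<and>
     (\<forall>i. q i \<in> frontier K \<and>
          q i \<notin> closed_segment (q (i - 1)) (q (i + 1)) \<and>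
          (let n = sgn (q i - q (i - 1)) - sgn (q (i + 1) - q i)
           in n \<noteq> 0 \<and> n \<in> outer_normals K (q i)))"

definition classical_billiard_trajectory ::
    "'a::euclidean_space set \<Rightarrow> nat \<Rightarrow> (int \<Rightarrow> 'a) \<Rightarrow> bool" where
  "classical_billiard_trajectory K m q \<longleftrightarrow>
     generalized_billiard_trajectory K m q \<and> (\<forall>i. smooth_point K (q i))"

end

theory Submission
  imports Defs
begin

text \<open>
  For each vertex \<open>c\<close> of the simplex let \<open>w c\<close> be the outer normal of the opposite facet, scaled as minus the
  gradient of the barycentric coordinate of \<open>c\<close>. These normals add up to zero, and acuteness of the dihedral angles says
  that \<open>w c \<bullet> w d < 0\<close> for \<open>c \<noteq> d\<close> (\<open>acute_imp_inner_neg\<close>).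

  Scale the directions of a trajectory to a common length \<open>R\<close>. The law of reflection then asks that the directions
  before and after a bounce differ by a positive multiple of the normal. Hence suppose that, for some cyclic order \<open>\<sigma>\<close> of
  the facets, a closed polygon \<open>p\<close> with \<open>p (i - 1) - p i = w (\<sigma> i)\<close> is inscribed in a sphere of radius
  \<open>R\<close> around the origin, and that there are positive weights \<open>l i\<close> with \<open>\<Sum> l i p i = 0\<close>. The
  edges \<open>l i p i\<close> form a closed polygon \<open>x\<close> which obeys the law of reflection; its edge lengths are proportional
  to the \<open>l i\<close>. In other words, the centre of the circumscribed sphere of \<open>p\<close> has to lie inside the convex hull.

  Such an order exists (\<open>balanced_closed_path\<close>): one chooses it so that the smallest ball around the vertices of \<open>p\<close> is
  as large as possible, and breaks ties by the sum of the squared distances from the centre. The centre is a convex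
  combination of the vertices on the boundary of the ball (\<open>smallest_enclosing_ball\<close>), and if a vertex had weight zero,
  exchanging its two edges would contradict the choice.

  It remains to see that the polygon \<open>x\<close> fits into the simplex. Along \<open>x\<close>, the component of the direction in
  direction \<open>w (\<sigma> i)\<close> is negative just after the bounce at \<open>x i\<close> and increases at each further bounce, so
  \<open>x i\<close> is the only vertex at which \<open>w (\<sigma> i)\<close> is maximal (\<open>vertex_is_unique_maximum\<close>). Therefore the hyperplanes
  through the \<open>x i\<close> with these normals bound a homothetic copy of the simplex, with each \<open>x i\<close> in the relative
  interior of its facet. A homothety moves the copy to the given simplex. The bounce points are smooth since they
  are in the relative interiors of facets (\<open>facet_interior_point\<close>).
\<close>

section \<open>Periodic sequences over the integers\<close>

lemma periodic_mod:
  fixes f :: "int \<Rightarrow> 'b"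
  assumes "\<And>i. f (i + m) = f i"
  shows "f (i mod m) = f i"
proof -
  have nat_step: "f (i + int n * m) = f i" for i n
  proof (induction n)
    case (Suc n)
    have "i + int (Suc n) * m = (i + int n * m) + m" by (simp add: algebra_simps)
    with Suc assms show ?case by metis
  qed simp
  have "f (i + k * m) = f i" for i k
  proof (cases k rule: int_cases2)
    case (nonneg n) with nat_step show ?thesis by simp
  next
    case (nonpos n) with nat_step[of "i - int n * m" n] show ?thesis by simp
  qed
  from this[of "i mod m" "i div m"] show ?thesis by simp
qed

lemma periodic_cong:
  fixes f :: "int \<Rightarrow> 'b"
  assumes "\<And>i. f (i + m) = f i" "i mod m = j mod m"
  shows "f i = f j"
  using periodic_mod[of f m i] periodic_mod[of f m j] assms by simp

lemma bij_betw_mod_window: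
  fixes m :: int
  assumes "m > 0"
  shows "bij_betw (\<lambda>i. i mod m) {a..<a + m} {0..<m}"
proof (rule bij_betw_imageI)
  show inj: "inj_on (\<lambda>i. i mod m) {a..<a + m}"
  proof (rule inj_onI)
    fix i j assume "i \<in> {a..<a + m}" "j \<in> {a..<a + m}" "i mod m = j mod m"
    then have "m dvd i - j" "\<bar>i - j\<bar> < m" by (auto simp: mod_eq_dvd_iff)
    then show "i = j" using dvd_imp_le_int[of "i - j" m] by auto
  qed
  show "(\<lambda>i. i mod m) ` {a..<a + m} = {0..<m}"
    using inj assms by (intro card_subset_eq) (auto simp: card_image)
qed

lemma sum_period_window:
  fixes f :: "int \<Rightarrow> 'b::comm_monoid_add"
  assumes "m > 0" "\<And>i. f (i + m) = f i"
  shows "(\<Sum>i\<in>{a..<a + m}. f i) = (\<Sum>i\<in>{0..<m}. f i)"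
proof -
  have "(\<Sum>i\<in>{a..<a + m}. f i) = (\<Sum>i\<in>{a..<a + m}. f (i mod m))"
    using periodic_mod[of f m] assms(2) by simp
  also have "\<dots> = (\<Sum>i\<in>{0..<m}. f i)"
    by (rule sum.reindex_bij_betw[OF bij_betw_mod_window[OF assms(1)]])
  finally show ?thesis .
qed

lemma int_atLeastLessThan_Suc:
  fixes a b :: int
  assumes "a \<le> b"
  shows "{a..<b + 1} = insert b {a..<b}"
  using assms by auto

text \<open>The sequence \<open>F i\<close> is the sum of \<open>f\<close> from \<open>0\<close> up to the residue of \<open>i\<close>; the vanishing of the sum over a
  period makes it close up. It serves twice: to turn edge vectors into the vertices of a closed polygon.\<close>

lemma periodic_antidifference:
  fixes f :: "int \<Rightarrow> 'b::ab_group_add"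
  assumes "m > 0" "\<And>i. f (i + m) = f i" "(\<Sum>i\<in>{0..<m}. f i) = 0"
  obtains F where "\<And>i. F (i + m) = F i" "\<And>i. F (i + 1) - F i = f i"
proof
  define F where "F i = (\<Sum>k\<in>{0..<i mod m}. f k)" for i
  show "F (i + m) = F i" for i by (simp add: F_def)
  show "F (i + 1) - F i = f i" for i
  proof -
    have r: "0 \<le> i mod m" "i mod m < m" using assms(1) by auto
    have step: "(\<Sum>k\<in>{0..<i mod m + 1}. f k) = f i + F i"
      using r periodic_mod[of f m i] assms(2) by (simp add: int_atLeastLessThan_Suc F_def)
    have "(i + 1) mod m = (i mod m + 1) mod m" by (simp add: mod_add_left_eq)
    show ?thesis
    proof (cases "i mod m + 1 < m")
      case True
      then have "(i + 1) mod m = i mod m + 1"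
        using r \<open>(i + 1) mod m = _\<close> by simp
      then show ?thesis using step by (simp add: F_def)
    next
      case False
      then have last: "i mod m + 1 = m" using r by linarith
      then have "F (i + 1) = 0" using \<open>(i + 1) mod m = _\<close> by (simp add: F_def)
      moreover have "f i + F i = 0" using step last assms(3) by simp
      ultimately show ?thesis by (metis add_eq_0_iff diff_0 minus_minus)
    qed
  qed
qed

lemma constant_if_step_constant:
  fixes f :: "int \<Rightarrow> 'b"
  assumes "\<And>i. f (i - 1) = f i"
  shows "f i = f j"
proof -
  have "f i = f 0" for i
  proof (induction i rule: int_induct[where k = 0])
    case (step1 i) then show ?case using assms[of "i + 1"] by simp
  next
    case (step2 i) then show ?case using assms[of i] by simp
  qed simp
  then show ?thesis by metis
qed

section \<open>Cyclic orders of a finite set\<close>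

text \<open>The residue condition, instead of bijectivity on one fixed period, makes the notion visibly invariant under
  shifts and under exchanging two neighbours, including the two that straddle the end of a period.\<close>

definition cyclic_enumeration :: "'b set \<Rightarrow> (int \<Rightarrow> 'b) \<Rightarrow> bool" where
  "cyclic_enumeration C \<sigma> \<longleftrightarrow>
     range \<sigma> = C \<and> (\<forall>i j. \<sigma> i = \<sigma> j \<longleftrightarrow> i mod int (card C) = j mod int (card C))"

lemma cyclic_enumeration_periodic:
  assumes "cyclic_enumeration C \<sigma>"
  shows "\<sigma> (i + int (card C)) = \<sigma> i"
  using assms unfolding cyclic_enumeration_def by simp

lemma cyclic_enumeration_bij:
  assumes "cyclic_enumeration C \<sigma>" "card C > 0"
  shows "bij_betw \<sigma> {0..<int (card C)} C"
proof (rule bij_betw_imageI)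
  show "inj_on \<sigma> {0..<int (card C)}"
    using assms unfolding cyclic_enumeration_def inj_on_def by (metis atLeastLessThan_iff mod_pos_pos_trivial)
  show "\<sigma> ` {0..<int (card C)} = C"
  proof
    show "C \<subseteq> \<sigma> ` {0..<int (card C)}"
    proof
      fix c assume "c \<in> C"
      then obtain i where "c = \<sigma> i" using assms unfolding cyclic_enumeration_def by blast
      moreover have "\<sigma> i = \<sigma> (i mod int (card C))"
        using assms unfolding cyclic_enumeration_def by simp
      moreover have "i mod int (card C) \<in> {0..<int (card C)}" using assms(2) by simp
      ultimately show "c \<in> \<sigma> ` {0..<int (card C)}" by blast
    qed
  qed (use assms in \<open>auto simp: cyclic_enumeration_def\<close>)
qed

lemma finite_cyclic_enumerations:
  assumes "finite C" "card C > 0"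
  shows "finite {\<sigma>. cyclic_enumeration C \<sigma>}"
proof (rule finite_imageD)
  let ?r = "\<lambda>\<sigma>::int \<Rightarrow> _. restrict \<sigma> {0..<int (card C)}"
  have "?r ` {\<sigma>. cyclic_enumeration C \<sigma>} \<subseteq> ({0..<int (card C)} \<rightarrow>\<^sub>E C)"
    by (auto simp: cyclic_enumeration_def)
  then show "finite (?r ` {\<sigma>. cyclic_enumeration C \<sigma>})"
    using assms(1) by (meson finite_PiE finite_atLeastLessThan_int finite_subset)
  show "inj_on ?r {\<sigma>. cyclic_enumeration C \<sigma>}"
  proof (rule inj_onI, rule ext)
    fix \<sigma> \<tau> :: "int \<Rightarrow> _" and i
    assume "\<sigma> \<in> {\<sigma>. cyclic_enumeration C \<sigma>}" "\<tau> \<in> {\<sigma>. cyclic_enumeration C \<sigma>}" and eq: "?r \<sigma> = ?r \<tau>"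
    then have "\<sigma> (i mod int (card C)) = \<sigma> i" "\<tau> (i mod int (card C)) = \<tau> i"
      unfolding cyclic_enumeration_def by simp_all
    moreover have "\<sigma> (i mod int (card C)) = \<tau> (i mod int (card C))"
      using fun_cong[OF eq, of "i mod int (card C)"] assms(2) by simp
    ultimately show "\<sigma> i = \<tau> i" by simp
  qed
qed

lemma cyclic_enumeration_exists:
  assumes "finite C" "card C > 0"
  shows "\<exists>\<sigma>. cyclic_enumeration C \<sigma>"
proof -
  let ?m = "int (card C)"
  have "finite {0..<?m}" "card {0..<?m} = card C" by simp_all
  then obtain h where h: "bij_betw h {0..<?m} C"
    using finite_same_card_bij[OF _ assms(1)] by metis
  define \<sigma> where "\<sigma> i = h (i mod ?m)" for i
  have mod: "i mod ?m \<in> {0..<?m}" for i using assms(2) by simp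
  have "range \<sigma> = h ` {0..<?m}"
  proof
    show "h ` {0..<?m} \<subseteq> range \<sigma>"
    proof
      fix x assume "x \<in> h ` {0..<?m}"
      then obtain i where "i \<in> {0..<?m}" "x = h i" by blast
      then have "x = \<sigma> i" by (simp add: \<sigma>_def)
      then show "x \<in> range \<sigma>" by simp
    qed
  qed (use mod in \<open>auto simp: \<sigma>_def\<close>)
  moreover have "\<sigma> i = \<sigma> j \<longleftrightarrow> i mod ?m = j mod ?m" for i j
    using h mod unfolding \<sigma>_def bij_betw_def inj_on_def by metis
  ultimately have "cyclic_enumeration C \<sigma>"
    using h by (simp add: cyclic_enumeration_def bij_betw_def)
  then show ?thesis by blast
qed

lemma mod_consecutive_neq:
  fixes m :: int
  assumes "m \<ge> 2"
  shows "(i + 1) mod m \<noteq> i mod m" "(i - 1) mod m \<noteq> i mod m"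
  using assms zdvd_not_zless[of 1 m] by (auto simp: mod_eq_dvd_iff)

text \<open>The exchange of the neighbours \<open>k\<close> and \<open>k + 1\<close>, done in all periods at once, is an involution \<open>\<tau>\<close> of the
  integers that respects residues.\<close>

lemma cyclic_enumeration_swap:
  fixes k :: int
  assumes \<sigma>: "cyclic_enumeration C \<sigma>" and m: "card C \<ge> 2"
  defines "m \<equiv> int (card C)"
  defines "\<tau> i \<equiv> if i mod m = k mod m then i + 1 else if i mod m = (k + 1) mod m then i - 1 else i"
  shows "cyclic_enumeration C (\<lambda>i. \<sigma> (\<tau> i))"
proof -
  have m2: "m \<ge> 2" using m by (simp add: m_def)
  have shift: "(i + 1) mod m = (j + 1) mod m \<longleftrightarrow> i mod m = j mod m"
    "(i - 1) mod m = (j - 1) mod m \<longleftrightarrow> i mod m = j mod m" for i j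
    by (simp_all add: mod_eq_dvd_iff)
  have shift': "(i - 1) mod m = j mod m \<longleftrightarrow> i mod m = (j + 1) mod m" for i j
    by (simp add: mod_eq_dvd_iff algebra_simps)
  have ne: "(i + 1) mod m \<noteq> i mod m" for i using mod_consecutive_neq m2 by blast
  have "(2 + k) mod m \<noteq> (k + 1) mod m" using ne[of "k + 1"] by (simp add: algebra_simps)
  then have invol: "\<tau> (\<tau> i) = i" for i
    unfolding \<tau>_def using shift shift' ne by auto
  have cong: "\<tau> i mod m = \<tau> j mod m" if "i mod m = j mod m" for i j
    unfolding \<tau>_def using that shift by auto
  have "\<tau> i mod m = \<tau> j mod m \<longleftrightarrow> i mod m = j mod m" for i j
    using cong invol by metis
  moreover have "range (\<lambda>i. \<sigma> (\<tau> i)) = range \<sigma>"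
  proof -
    have "surj \<tau>" using invol by (rule surjI)
    then show ?thesis using image_image[of \<sigma> \<tau> UNIV] by simp
  qed
  ultimately show ?thesis
    using \<sigma> unfolding cyclic_enumeration_def m_def by simp
qed

section \<open>Smallest enclosing balls\<close>

text \<open>The weights belong to the indices, not to the points, so that repeated points are allowed.\<close>

lemma convex_hull_finite_family:
  fixes f :: "'i \<Rightarrow> 'a::real_vector"
  assumes "finite I" "z \<in> convex hull (f ` I)"
  obtains l where "\<And>i. i \<in> I \<Longrightarrow> l i \<ge> 0" "sum l I = 1" "z = (\<Sum>i\<in>I. l i *\<^sub>R f i)"
proof -
  have "convex hull (f ` I) \<subseteq> {(\<Sum>i\<in>I. l i *\<^sub>R f i) | l. (\<forall>i\<in>I. l i \<ge> 0) \<and> sum l I = 1}"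
    (is "_ \<subseteq> ?H")
  proof (rule hull_minimal)
    show "f ` I \<subseteq> ?H"
    proof
      fix y assume "y \<in> f ` I"
      then obtain k where k: "k \<in> I" "y = f k" by blast
      let ?l = "\<lambda>i. if i = k then 1 else (0::real)"
      have "(\<Sum>i\<in>I. ?l i *\<^sub>R f i) = (\<Sum>i\<in>I. if i = k then f i else 0)"
        by (intro sum.cong) auto
      then have "y = (\<Sum>i\<in>I. ?l i *\<^sub>R f i)" "sum ?l I = 1"
        using k assms(1) by simp_all
      then show "y \<in> ?H" by (intro CollectI exI[of _ ?l]) auto
    qed
    show "convex ?H"
    proof (rule convexI, clarify)
      fix u v :: real and l l' :: "'i \<Rightarrow> real"
      assume uv: "u \<ge> 0" "v \<ge> 0" "u + v = 1"
        and l: "\<forall>i\<in>I. l i \<ge> 0" "sum l I = 1" "\<forall>i\<in>I. l' i \<ge> 0" "sum l' I = 1"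
      let ?l = "\<lambda>i. u * l i + v * l' i"
      have "u *\<^sub>R (\<Sum>i\<in>I. l i *\<^sub>R f i) + v *\<^sub>R (\<Sum>i\<in>I. l' i *\<^sub>R f i) = (\<Sum>i\<in>I. ?l i *\<^sub>R f i)"
        unfolding scaleR_left_distrib sum.distrib by (simp add: scaleR_sum_right)
      moreover have "\<forall>i\<in>I. ?l i \<ge> 0" using uv l by simp
      moreover have "sum ?l I = 1"
        using uv l by (simp add: sum.distrib flip: sum_distrib_left)
      ultimately show "\<exists>m. u *\<^sub>R (\<Sum>i\<in>I. l i *\<^sub>R f i) + v *\<^sub>R (\<Sum>i\<in>I. l' i *\<^sub>R f i)
          = (\<Sum>i\<in>I. m i *\<^sub>R f i) \<and> (\<forall>i\<in>I. m i \<ge> 0) \<and> sum m I = 1"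
        by (intro exI[of _ ?l]) auto
    qed
  qed
  then have "z \<in> ?H" using assms(2) by (rule subsetD)
  then show thesis using that by blast
qed

text \<open>Lifting the points to the paraboloid \<open>p \<mapsto> (p, \<bar>p\<bar>\<^sup>2)\<close> gives both the centre and the weights at once:
  they come from the point \<open>(c, s)\<close> of the lifted convex hull that maximises the height \<open>s - \<bar>c\<bar>\<^sup>2\<close>
  above the paraboloid, which is the squared radius.\<close>

lemma smallest_enclosing_ball:
  fixes p :: "'i \<Rightarrow> 'a::euclidean_space"
  assumes "finite I" "I \<noteq> {}"
  obtains c l R where "\<And>i. i \<in> I \<Longrightarrow> l i \<ge> 0" "sum l I = 1" "(\<Sum>i\<in>I. l i *\<^sub>R p i) = c"
    "R \<ge> 0" "\<And>i. i \<in> I \<Longrightarrow> norm (p i - c) \<le> R"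
    "\<And>i. i \<in> I \<Longrightarrow> l i > 0 \<Longrightarrow> norm (p i - c) = R"
proof -
  let ?z = "\<lambda>i. (p i, (norm (p i))\<^sup>2)"
  let ?F = "\<lambda>z::'a \<times> real. snd z - (norm (fst z))\<^sup>2"
  have "compact (convex hull (?z ` I))" "convex hull (?z ` I) \<noteq> {}"
    using assms by (auto intro: finite_imp_compact_convex_hull)
  moreover have "continuous_on (convex hull (?z ` I)) ?F"
    by (intro continuous_intros)
  ultimately obtain z where z: "z \<in> convex hull (?z ` I)"
    and max: "\<And>y. y \<in> convex hull (?z ` I) \<Longrightarrow> ?F y \<le> ?F z"
    using continuous_attains_sup[of "convex hull (?z ` I)" ?F] by blast
  obtain c s where cs: "z = (c, s)" by fastforce
  obtain l where l: "\<And>i. i \<in> I \<Longrightarrow> l i \<ge> 0" "sum l I = 1" and zl: "z = (\<Sum>i\<in>I. l i *\<^sub>R ?z i)"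
    using convex_hull_finite_family[OF assms(1) z] by blast
  have c: "(\<Sum>i\<in>I. l i *\<^sub>R p i) = c" and s: "(\<Sum>i\<in>I. l i * (norm (p i))\<^sup>2) = s"
    using arg_cong[OF zl, of fst] arg_cong[OF zl, of snd] by (simp_all add: cs fst_sum snd_sum)
  \<comment> \<open>The squared radius; optimality of \<open>(c, s)\<close> in the direction of each lifted point yields the bound on its distance.\<close>
  define A where "A = s - (norm c)\<^sup>2"
  have le: "(norm (p i - c))\<^sup>2 \<le> A" if "i \<in> I" for i
  proof -
    let ?d = "(norm (p i - c))\<^sup>2"
    have key: "t * (?d - A - t * ?d) \<le> 0" if t: "0 < t" "t \<le> 1" for t
    proof -
      have "(1 - t) *\<^sub>R z + t *\<^sub>R ?z i \<in> convex hull (?z ` I)"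
        using z \<open>i \<in> I\<close> t by (intro convexD[OF convex_convex_hull]) (auto intro: hull_inc)
      from max[OF this]
      have "((1 - t) * s + t * (norm (p i))\<^sup>2) - (norm ((1 - t) *\<^sub>R c + t *\<^sub>R p i))\<^sup>2 \<le> A"
        by (simp add: cs A_def)
      then show ?thesis
        unfolding A_def power2_norm_eq_inner
        by (simp add: inner_simps inner_commute[of c "p i"] algebra_simps power2_eq_square)
    qed
    show ?thesis
    proof (rule ccontr)
      assume "\<not> ?d \<le> A"
      then have g: "?d - A > 0" by simp
      have d: "?d \<ge> 0" by simp
      define t where "t = min 1 ((?d - A) / (2 * (?d + 1)))"
      have t: "0 < t" "t \<le> 1" unfolding t_def using g d by (auto intro!: divide_pos_pos add_nonneg_pos)
      have "t * (2 * (?d + 1)) \<le> (?d - A) / (2 * (?d + 1)) * (2 * (?d + 1))"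
        unfolding t_def using d by (intro mult_right_mono) auto
      also have "\<dots> = ?d - A" using d by (simp add: add_nonneg_eq_0_iff)
      finally have "t * ?d + t * ?d + 2 * t \<le> ?d - A" by (simp add: algebra_simps)
      moreover have "t * ?d \<ge> 0" using t(1) d by (intro mult_nonneg_nonneg) auto
      ultimately have "?d - A - t * ?d > 0" using t(1) by linarith
      then have "t * (?d - A - t * ?d) > 0" using t(1) by (rule mult_pos_pos[rotated])
      then show False using key[OF t(1,2)] by linarith
    qed
  qed
  \<comment> \<open>Complementary slackness: a weighted sum of nonnegative defects that vanishes.\<close>
  have "(\<Sum>i\<in>I. l i * (A - (norm (p i - c))\<^sup>2)) =
      A - (\<Sum>i\<in>I. l i * (norm (p i))\<^sup>2) + 2 * (c \<bullet> (\<Sum>i\<in>I. l i *\<^sub>R p i)) - (norm c)\<^sup>2"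
    using l(2) unfolding power2_norm_eq_inner
    by (simp add: inner_simps inner_commute algebra_simps inner_sum_right sum.distrib sum_subtractf
          flip: sum_distrib_left sum_distrib_right) (simp add: sum_distrib_left mult.left_commute)
  also have "\<dots> = 0" unfolding s c by (simp add: A_def power2_norm_eq_inner)
  finally have "\<forall>i\<in>I. l i * (A - (norm (p i - c))\<^sup>2) = 0"
    using l(1) le assms(1) by (subst (asm) sum_nonneg_eq_0_iff) auto
  then have eq: "(norm (p i - c))\<^sup>2 = A" if "i \<in> I" "l i > 0" for i using that by auto
  obtain i0 where "i0 \<in> I" using assms by blast
  then have "A \<ge> 0" using le[of i0] by (meson order_trans zero_le_power2)
  show thesis
  proof (rule that[of l c "sqrt A"])
    show "norm (p i - c) \<le> sqrt A" if "i \<in> I" for i using le[OF that] by (simp add: real_le_rsqrt)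
    show "norm (p i - c) = sqrt A" if "i \<in> I" "l i > 0" for i using real_sqrt_unique[OF eq[OF that]] by simp
  qed (use l c \<open>A \<ge> 0\<close> in auto)
qed

section \<open>A balanced closed polygon inscribed in a sphere\<close>

text \<open>The closed polygon with edge vectors \<open>- w (\<sigma> i)\<close>, translated so that its smallest enclosing ball, of radius
  \<open>R\<close>, is centred at the origin; \<open>l\<close> are the weights that certify this, as in the lemma on the smallest enclosing ball.\<close>

definition centred_path ::
    "('b \<Rightarrow> 'a::euclidean_space) \<Rightarrow> int \<Rightarrow> (int \<Rightarrow> 'b) \<Rightarrow> (int \<Rightarrow> 'a) \<Rightarrow> (int \<Rightarrow> real) \<Rightarrow> real \<Rightarrow> bool" where
  "centred_path w m \<sigma> p l R \<longleftrightarrow>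
     (\<forall>i. p (i + m) = p i) \<and> (\<forall>i. l (i + m) = l i) \<and> (\<forall>i. p (i - 1) - p i = w (\<sigma> i)) \<and>
     (\<forall>i. l i \<ge> 0) \<and> (\<Sum>i\<in>{0..<m}. l i) = 1 \<and> (\<Sum>i\<in>{0..<m}. l i *\<^sub>R p i) = 0 \<and>
     (\<forall>i. norm (p i) \<le> R) \<and> (\<forall>i. l i > 0 \<longrightarrow> norm (p i) = R)"

lemma centred_path_exists:
  fixes w :: "'b \<Rightarrow> 'a::euclidean_space"
  assumes \<sigma>: "cyclic_enumeration C \<sigma>" and C: "card C > 0" and w: "sum w C = 0"
  shows "\<exists>p l R. centred_path w (int (card C)) \<sigma> p l R"
proof -
  define m where "m = int (card C)"
  have m: "m > 0" using C by (simp add: m_def)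
  have per\<sigma>: "\<sigma> (i + m) = \<sigma> i" for i
    unfolding m_def by (rule cyclic_enumeration_periodic[OF \<sigma>])
  have "(\<Sum>i\<in>{0..<m}. - w (\<sigma> (i + 1))) = - (\<Sum>i\<in>{1..<1 + m}. w (\<sigma> i))"
    unfolding sum_negf
    by (intro arg_cong[where f = uminus] sum.reindex_bij_witness[of _ "\<lambda>i. i - 1" "\<lambda>i. i + 1"]) auto
  also have "\<dots> = - (\<Sum>i\<in>{0..<m}. w (\<sigma> i))"
    using sum_period_window[of m "\<lambda>i. w (\<sigma> i)" 1] m per\<sigma> by simp
  also have "\<dots> = 0"
    using sum.reindex_bij_betw[OF cyclic_enumeration_bij[OF \<sigma> C], of w] w by (simp add: m_def)
  finally have zero: "(\<Sum>i\<in>{0..<m}. - w (\<sigma> (i + 1))) = 0" .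
  have per': "- w (\<sigma> (i + m + 1)) = - w (\<sigma> (i + 1))" for i
    using per\<sigma>[of "i + 1"] by (simp add: algebra_simps)
  obtain P where perP: "\<And>i. P (i + m) = P i" and P: "\<And>i. P (i + 1) - P i = - w (\<sigma> (i + 1))"
    using periodic_antidifference[OF m per' zero] by blast
  have "finite {0..<m}" "{0..<m} \<noteq> {}" using m by auto
  then obtain c l R where l: "\<And>i. i \<in> {0..<m} \<Longrightarrow> l i \<ge> 0" "sum l {0..<m} = 1"
    "(\<Sum>i\<in>{0..<m}. l i *\<^sub>R P i) = c"
    and R: "\<And>i. i \<in> {0..<m} \<Longrightarrow> norm (P i - c) \<le> R"
    "\<And>i. i \<in> {0..<m} \<Longrightarrow> l i > 0 \<Longrightarrow> norm (P i - c) = R"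
    by (rule smallest_enclosing_ball[where p = P]) blast
  have mod: "i mod m \<in> {0..<m}" for i using m by simp
  have Pmod: "P (i mod m) = P i" for i using periodic_mod[of P m] perP by blast
  have "centred_path w m \<sigma> (\<lambda>i. P i - c) (\<lambda>i. l (i mod m)) R"
    unfolding centred_path_def
  proof (intro conjI allI impI)
    fix i
    show "P (i - 1) - c - (P i - c) = w (\<sigma> i)"
      using P[of "i - 1"] by (simp add: algebra_simps) 
    show "norm (P i - c) \<le> R" using R(1)[OF mod[of i]] by (simp add: Pmod)
    show "norm (P i - c) = R" if "l (i mod m) > 0" using R(2)[OF mod[of i] that] by (simp add: Pmod)
    show "(\<Sum>i\<in>{0..<m}. l (i mod m) *\<^sub>R (P i - c)) = 0"
      using l(2,3) by (simp add: scaleR_diff_right sum_subtractf flip: scaleR_left.sum)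
  qed (use perP l mod in simp_all)
  then show ?thesis unfolding m_def by blast
qed

text \<open>The main step. Take a cyclic order for which the enclosing radius is largest and, among these, the sum of the
  squared distances of the vertices from the centre is largest. Suppose \<open>p k\<close> has weight \<open>0\<close>. Exchanging the edges on
  both sides of \<open>p k\<close> replaces this vertex by \<open>p (k - 1) + p (k + 1) - p k\<close> and keeps all others. The points that
  determine the ball are still there, so the radius does not decrease; it does not increase either, by maximality, and
  hence the ball is the same. The new vertex is therefore no farther from the centre than \<open>p k\<close>. As the two edge
  vectors have a negative inner product, the parallelogram with these four corners gives
  \<open>\<bar>p (k - 1)\<bar>\<^sup>2 + \<bar>p (k + 1)\<bar>\<^sup>2 < 2 \<bar>p k\<bar>\<^sup>2\<close>. This is impossible for a vertex nearest to the centre, so such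
  a vertex has positive weight and lies on the sphere. Then all vertices lie on it, each is nearest to the centre, and
  every weight is positive.\<close>

lemma balanced_closed_path:
  fixes w :: "'b \<Rightarrow> 'a::euclidean_space"
  assumes C: "finite C" "card C \<ge> 2" and w: "sum w C = 0"
    and obtuse: "\<And>c d. c \<in> C \<Longrightarrow> d \<in> C \<Longrightarrow> c \<noteq> d \<Longrightarrow> w c \<bullet> w d < 0"
  obtains \<sigma> p l R where "cyclic_enumeration C \<sigma>" "centred_path w (int (card C)) \<sigma> p l R"
    "\<And>i. l i > 0" "\<And>i. norm (p i) = R"
proof -
  define m where "m = int (card C)"
  have m: "m \<ge> 2" "m > 0" using C by (simp_all add: m_def)
  let ?E = "{\<sigma>. cyclic_enumeration C \<sigma>}"
  have E: "finite ?E" "?E \<noteq> {}"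
    using finite_cyclic_enumerations cyclic_enumeration_exists C by fastforce+
  have "\<forall>\<sigma>. \<exists>p l R. cyclic_enumeration C \<sigma> \<longrightarrow> centred_path w m \<sigma> p l R"
    using centred_path_exists[OF _ _ w] C unfolding m_def by fastforce
  then obtain P L R where "\<forall>\<sigma>. cyclic_enumeration C \<sigma> \<longrightarrow> centred_path w m \<sigma> (P \<sigma>) (L \<sigma>) (R \<sigma>)"
    by metis
  then have path: "centred_path w m \<sigma> (P \<sigma>) (L \<sigma>) (R \<sigma>)" if "\<sigma> \<in> ?E" for \<sigma>
    using that by blast
  define V where "V \<sigma> = (\<Sum>i\<in>{0..<m}. (norm (P \<sigma> i))\<^sup>2)" for \<sigma>
  let ?A = "{\<sigma> \<in> ?E. \<forall>\<tau>\<in>?E. R \<tau> \<le> R \<sigma>}"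
  have "Max (R ` ?E) \<in> R ` ?E" using E by (intro Max_in) auto
  then obtain \<sigma>0 where \<sigma>0: "Max (R ` ?E) = R \<sigma>0" and \<sigma>0E: "\<sigma>0 \<in> ?E" by (rule imageE)
  have "R \<tau> \<le> R \<sigma>0" if "\<tau> \<in> ?E" for \<tau>
    unfolding \<sigma>0[symmetric] using that E(1) by (intro Max_ge finite_imageI imageI)
  with \<sigma>0E have "\<sigma>0 \<in> ?A" by simp
  then have "V ` ?A \<noteq> {}" by blast
  moreover have finA: "finite (V ` ?A)" using E(1) by simp
  ultimately have "Max (V ` ?A) \<in> V ` ?A" by (intro Max_in)
  then obtain \<sigma> where Vmax0: "Max (V ` ?A) = V \<sigma>" and "\<sigma> \<in> ?A" by (rule imageE)
  have Vmax: "V \<tau> \<le> V \<sigma>" if "\<tau> \<in> ?A" for \<tau>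
    unfolding Vmax0[symmetric] using that finA by (intro Max_ge imageI)
  have \<sigma>: "cyclic_enumeration C \<sigma>" and Rmax: "\<And>\<tau>. \<tau> \<in> ?E \<Longrightarrow> R \<tau> \<le> R \<sigma>"
    using \<open>\<sigma> \<in> ?A\<close> by auto
  define p l r where "p = P \<sigma>" and "l = L \<sigma>" and "r = R \<sigma>"
  have cp: "centred_path w m \<sigma> p l r" using path[of \<sigma>] \<sigma> by (simp add: p_def l_def r_def)
  then have perp: "\<And>i. p (i + m) = p i" and perl: "\<And>i. l (i + m) = l i"
    and step: "\<And>i. p (i - 1) - p i = w (\<sigma> i)"
    and l: "\<And>i. l i \<ge> 0" "(\<Sum>i\<in>{0..<m}. l i) = 1" "(\<Sum>i\<in>{0..<m}. l i *\<^sub>R p i) = 0"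
    and r: "\<And>i. norm (p i) \<le> r" "\<And>i. l i > 0 \<Longrightarrow> norm (p i) = r"
    unfolding centred_path_def by auto
  have pcong: "p i = p j" and lcong: "l i = l j" if "i mod m = j mod m" for i j
    using periodic_cong[of p m, OF perp that] periodic_cong[of l m, OF perl that] by auto
  have \<sigma>cong: "\<sigma> i = \<sigma> j \<longleftrightarrow> i mod m = j mod m" for i j
    using \<sigma> unfolding cyclic_enumeration_def m_def by blast
  have \<sigma>C: "\<sigma> i \<in> C" for i using \<sigma> unfolding cyclic_enumeration_def by blast
  have concave: "(norm (p (k - 1)))\<^sup>2 + (norm (p (k + 1)))\<^sup>2 < 2 * (norm (p k))\<^sup>2" if lk: "l k = 0" for k
  proof -
    define u where "u = p (k - 1) + p (k + 1) - p k"
    define \<tau> where "\<tau> i = (if i mod m = k mod m then i + 1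
        else if i mod m = (k + 1) mod m then i - 1 else i)" for i
    have "cyclic_enumeration C (\<lambda>i. \<sigma> (\<tau> i))"
      using cyclic_enumeration_swap[OF \<sigma> C(2), of k] unfolding \<tau>_def m_def .
    then have \<rho>: "(\<lambda>i. \<sigma> (\<tau> i)) \<in> ?E" by simp
    define q s where "q = P (\<lambda>i. \<sigma> (\<tau> i))" and "s = R (\<lambda>i. \<sigma> (\<tau> i))"
    have q: "q (i + m) = q i" "q (i - 1) - q i = w (\<sigma> (\<tau> i))" "norm (q i) \<le> s" for i
      using path[OF \<rho>] unfolding centred_path_def q_def s_def by auto
    \<comment> \<open>The polygon of the exchanged order, before it is centred: it agrees with \<open>p\<close> except at \<open>k\<close>.\<close>
    define q0 where "q0 i = (if i mod m = k mod m then u else p i)" for i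
    have ne: "(i + 1) mod m \<noteq> i mod m" "(i - 1) mod m \<noteq> i mod m" for i
      using mod_consecutive_neq[OF m(1)] by blast+
    have shift: "(i - 1) mod m = j mod m \<longleftrightarrow> i mod m = (j + 1) mod m" for i j
      by (simp add: mod_eq_dvd_iff algebra_simps)
    have "q0 (i - 1) - q0 i = w (\<sigma> (\<tau> i))" for i
    proof -
      consider "i mod m = k mod m" | "i mod m = (k + 1) mod m" | "i mod m \<noteq> k mod m" "i mod m \<noteq> (k + 1) mod m"
        by blast
      then show ?thesis
      proof cases
        case 1
        then have "(i - 1) mod m \<noteq> k mod m" using ne(2)[of i] by simp
        moreover have "(i - 1) mod m = (k - 1) mod m" "(i + 1) mod m = (k + 1) mod m"
          using 1 by (auto simp: mod_eq_dvd_iff)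
        moreover have "u = p (k - 1) - w (\<sigma> (k + 1))"
          using step[of "k + 1"] by (simp add: u_def algebra_simps)
        ultimately show ?thesis
          using 1 pcong[of "i - 1" "k - 1"] \<sigma>cong[of "i + 1" "k + 1"] by (simp add: q0_def \<tau>_def)
      next
        case 2
        then have "i mod m \<noteq> k mod m" "(i - 1) mod m = k mod m" using ne(1)[of k] shift by auto
        moreover have "u - p (k + 1) = w (\<sigma> k)"
          using step[of k] by (simp add: u_def algebra_simps)
        ultimately show ?thesis
          using 2 pcong[of i "k + 1"] \<sigma>cong[of "i - 1" k] by (simp add: q0_def \<tau>_def)
      next
        case 3
        then show ?thesis using step[of i] shift by (simp add: q0_def \<tau>_def)
      qed
    qed
    then have "q0 (i - 1) = w (\<sigma> (\<tau> i)) + q0 i" for i by (simp add: diff_eq_eq)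
    moreover have "q (i - 1) = w (\<sigma> (\<tau> i)) + q i" for i using q(2)[of i] by (simp add: diff_eq_eq)
    ultimately have diff: "q (i - 1) - q0 (i - 1) = q i - q0 i" for i by simp
    define a where "a = q 0 - q0 0"
    have qa: "q i = q0 i + a" for i
      using constant_if_step_constant[of "\<lambda>i. q i - q0 i" i 0] diff by (simp add: a_def algebra_simps)
    have "s \<ge> 0" using q(3)[of 0] norm_ge_zero order_trans by blast
    \<comment> \<open>The centred polygon is a translate by some \<open>a\<close>. Averaging squared norms with the old weights, which do not see \<open>k\<close>, shows \<open>r\<^sup>2 + \<bar>a\<bar>\<^sup>2 \<le> s\<^sup>2\<close>.\<close>
    have "(\<Sum>i\<in>{0..<m}. l i * (norm (p i + a))\<^sup>2) \<le> (\<Sum>i\<in>{0..<m}. l i * s\<^sup>2)"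
    proof (rule sum_mono)
      fix i
      show "l i * (norm (p i + a))\<^sup>2 \<le> l i * s\<^sup>2"
      proof (cases "i mod m = k mod m")
        case True then show ?thesis using lcong[OF True] lk by simp
      next
        case False
        then have "norm (p i + a) \<le> s" using q(3)[of i] by (simp add: qa q0_def)
        then show ?thesis using l(1) by (intro mult_left_mono power_mono) auto
      qed
    qed
    also have "\<dots> = s\<^sup>2" using l(2) by (simp flip: sum_distrib_right)
    also have "(\<Sum>i\<in>{0..<m}. l i * (norm (p i + a))\<^sup>2)
        = (\<Sum>i\<in>{0..<m}. l i * (r\<^sup>2 + (norm a)\<^sup>2) + 2 * ((l i *\<^sub>R p i) \<bullet> a))"
    proof (rule sum.cong[OF refl])
      fix i
      have "l i * (norm (p i))\<^sup>2 = l i * r\<^sup>2" using r(2)[of i] l(1)[of i] by (cases "l i = 0") auto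
      moreover have "(norm (p i + a))\<^sup>2 = (norm (p i))\<^sup>2 + (norm a)\<^sup>2 + 2 * (p i \<bullet> a)"
        unfolding power2_norm_eq_inner by (simp add: inner_simps inner_commute)
      ultimately show "l i * (norm (p i + a))\<^sup>2 = l i * (r\<^sup>2 + (norm a)\<^sup>2) + 2 * ((l i *\<^sub>R p i) \<bullet> a)"
        by (simp add: algebra_simps)
    qed
    also have "\<dots> = r\<^sup>2 + (norm a)\<^sup>2"
    proof -
      have "(\<Sum>i\<in>{0..<m}. (l i *\<^sub>R p i) \<bullet> a) = 0"
        unfolding inner_sum_left[symmetric] l(3) by simp
      then show ?thesis
        unfolding sum.distrib sum_distrib_right[symmetric] sum_distrib_left[symmetric] l(2) by simp
    qed
    finally have rs: "r\<^sup>2 + (norm a)\<^sup>2 \<le> s\<^sup>2" .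
    have "s \<le> r" using Rmax[OF \<rho>] by (simp add: s_def r_def)
    then have "s\<^sup>2 \<le> r\<^sup>2" using \<open>s \<ge> 0\<close> by (intro power_mono)
    then have "(norm a)\<^sup>2 \<le> 0" "r\<^sup>2 \<le> s\<^sup>2" using rs zero_le_power2[of "norm a"] by linarith+
    then have a0: "a = 0" and "r \<le> s" using \<open>s \<ge> 0\<close> power2_le_imp_le by auto
    have "R \<upsilon> \<le> R (\<lambda>i. \<sigma> (\<tau> i))" if "\<upsilon> \<in> ?E" for \<upsilon>
      using Rmax[OF that] \<open>r \<le> s\<close> unfolding r_def s_def by (rule order_trans)
    with \<rho> have "(\<lambda>i. \<sigma> (\<tau> i)) \<in> ?A" by simp
    then have Vle: "V (\<lambda>i. \<sigma> (\<tau> i)) \<le> V \<sigma>" by (rule Vmax)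
    have km: "k mod m \<in> {0..<m}" using m by simp
    have "(\<Sum>i\<in>{0..<m}. (norm (q i))\<^sup>2) = (norm u)\<^sup>2 + (\<Sum>i\<in>{0..<m} - {k mod m}. (norm (p i))\<^sup>2)"
      using km by (subst sum.remove[of _ "k mod m"]) (auto simp: qa a0 q0_def intro!: sum.cong)
    moreover have "(\<Sum>i\<in>{0..<m}. (norm (p i))\<^sup>2) = (norm (p k))\<^sup>2 + (\<Sum>i\<in>{0..<m} - {k mod m}. (norm (p i))\<^sup>2)"
      using km pcong[of "k mod m" k] by (subst sum.remove[of _ "k mod m"]) auto
    ultimately have "(norm u)\<^sup>2 \<le> (norm (p k))\<^sup>2"
      using Vle unfolding V_def q_def p_def by linarith
    moreover have "(norm (p (k - 1)))\<^sup>2 + (norm (p (k + 1)))\<^sup>2 - (norm (p k))\<^sup>2 - (norm u)\<^sup>2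
        = 2 * ((p (k - 1) - p k) \<bullet> (p k - p (k + 1)))"
      unfolding u_def power2_norm_eq_inner by (simp add: inner_simps inner_commute algebra_simps)
    moreover have "(p (k - 1) - p k) \<bullet> (p k - p (k + 1)) < 0"
    proof -
      have "\<sigma> k \<noteq> \<sigma> (k + 1)" using \<sigma>cong[of k "k + 1"] ne(1)[of k] by simp
      then show ?thesis using obtuse[OF \<sigma>C \<sigma>C] step[of k] step[of "k + 1"] by simp
    qed
    ultimately show ?thesis by linarith
  qed
  have "Min ((\<lambda>i. norm (p i)) ` {0..<m}) \<in> (\<lambda>i. norm (p i)) ` {0..<m}"
    using m by (intro Min_in) auto
  then obtain k where k: "Min ((\<lambda>i. norm (p i)) ` {0..<m}) = norm (p k)" by (rule imageE)
  have min: "norm (p k) \<le> norm (p i)" for i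
  proof -
    have "norm (p k) \<le> norm (p (i mod m))"
      unfolding k[symmetric] using m(2) by (intro Min_le) auto
    then show ?thesis using pcong[of "i mod m" i] by simp
  qed
  have weight_pos: "l j > 0" if "norm (p j) = norm (p k)" for j
  proof (rule ccontr)
    assume "\<not> l j > 0"
    then have "l j = 0" using l(1)[of j] by simp
    from concave[OF this] have "(norm (p (j - 1)))\<^sup>2 + (norm (p (j + 1)))\<^sup>2 < 2 * (norm (p k))\<^sup>2"
      using that by simp
    moreover have "(norm (p k))\<^sup>2 \<le> (norm (p (j - 1)))\<^sup>2" "(norm (p k))\<^sup>2 \<le> (norm (p (j + 1)))\<^sup>2"
      using min by (auto intro: power_mono)
    ultimately show False by linarith
  qed
  have "norm (p k) = r" using weight_pos r(2) by blast
  then have all: "norm (p i) = r" for i using min[of i] r(1)[of i] by simp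
  show thesis
  proof (rule that[OF \<sigma>])
    show "centred_path w (int (card C)) \<sigma> p l r" using cp by (simp add: m_def)
    show "l i > 0" for i using weight_pos all by simp
    show "norm (p i) = r" for i by (rule all)
  qed
qed

section \<open>The bounce points are extreme\<close>

text \<open>Discrete convexity: the weighted increments change sign once, from negative to positive, so the partial sums stay
  below their common value at both ends.\<close>

lemma partial_sums_negative:
  fixes f g c :: "nat \<Rightarrow> real"
  assumes "g 0 = 0" "g m = 0" and g: "\<And>k. g (Suc k) = g k + c k * f k" and c: "\<And>k. c k > 0"
    and f0: "f 0 < 0" and inc: "\<And>k. Suc k < m \<Longrightarrow> f k < f (Suc k)" and k: "0 < k" "k < m"
  shows "g k < 0"
proof (rule ccontr)
  assume "\<not> g k < 0"
  have "\<exists>j<k. f j > 0"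
  proof (rule ccontr)
    assume none: "\<not> (\<exists>j<k. f j > 0)"
    have "j < k \<Longrightarrow> g (Suc j) < 0" for j
    proof (induction j)
      case 0 then show ?case using g[of 0] \<open>g 0 = 0\<close> f0 c[of 0] by (simp add: mult_pos_neg)
    next
      case (Suc j)
      then have "c (Suc j) * f (Suc j) \<le> 0"
        using none c[of "Suc j"] by (intro mult_nonneg_nonpos) (auto simp: not_less dest: spec[of _ "Suc j"])
      then show ?case using Suc g[of "Suc j"] by simp
    qed
    from this[of "k - 1"] show False using k \<open>\<not> g k < 0\<close> by simp
  qed
  then obtain j where j: "j < k" "f j > 0" by blast
  have pos: "f i > 0" if "j \<le> i" "i < m" for i
    using that(1) that(2)
  proof (induction i rule: dec_induct)
    case (step n) then show ?case using inc[of n] by simp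
  qed (use j in simp)
  have "g i > g k" if "Suc k \<le> i" "i \<le> m" for i
    using that(1) that(2)
  proof (induction i rule: dec_induct)
    case base then show ?case using g[of k] pos[of k] j c[of k] by simp
  next
    case (step n)
    then show ?case using g[of n] pos[of n] j c[of n] mult_pos_pos[of "c n" "f n"] by linarith
  qed
  from this[of m] show False using k \<open>\<not> g k < 0\<close> \<open>g m = 0\<close> by simp
qed

text \<open>Measured along \<open>w (\<sigma> i)\<close>, the direction \<open>p i\<close> just after the vertex \<open>x i\<close> points downwards, since
  \<open>p (i - 1)\<close> and \<open>p i\<close> have the same length and differ by \<open>w (\<sigma> i)\<close>. Every later vertex turns the direction
  upwards, because the inner products with \<open>w (\<sigma> i)\<close> are negative. So the height over one period is convex in the above
  sense and returns to its initial value only at the end.\<close>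

lemma vertex_is_unique_maximum:
  fixes w :: "'b \<Rightarrow> 'a::euclidean_space"
  assumes C: "card C \<ge> 2" and \<sigma>: "cyclic_enumeration C \<sigma>"
    and obtuse: "\<And>c d. c \<in> C \<Longrightarrow> d \<in> C \<Longrightarrow> c \<noteq> d \<Longrightarrow> w c \<bullet> w d < 0"
    and nz: "\<And>c. c \<in> C \<Longrightarrow> w c \<noteq> 0"
    and step: "\<And>i. p (i - 1) - p i = w (\<sigma> i)"
    and l: "\<And>i. l i > 0" and R: "\<And>i. norm (p i) = R"
    and x: "\<And>i. x (i + int (card C)) = x i" "\<And>i. x (i + 1) - x i = l i *\<^sub>R p i"
    and ij: "i mod int (card C) \<noteq> j mod int (card C)"
  shows "w (\<sigma> i) \<bullet> x j < w (\<sigma> i) \<bullet> x i"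
proof -
  define m where "m = int (card C)"
  have m: "m \<ge> 2" using C by (simp add: m_def)
  define f where "f k = w (\<sigma> i) \<bullet> p (i + int k)" for k
  define g where "g k = w (\<sigma> i) \<bullet> (x (i + int k) - x i)" for k
  have \<sigma>C: "\<sigma> i \<in> C" for i using \<sigma> unfolding cyclic_enumeration_def by blast
  have "f 0 < 0"
  proof -
    have "(norm (p (i - 1)))\<^sup>2 = (norm (p i))\<^sup>2" using R by simp
    moreover have "p (i - 1) = p i + w (\<sigma> i)" using step[of i] by (simp add: algebra_simps)
    ultimately have "2 * (w (\<sigma> i) \<bullet> p i) = - (w (\<sigma> i) \<bullet> w (\<sigma> i))"
      unfolding power2_norm_eq_inner by (simp add: inner_simps inner_commute)
    moreover have "w (\<sigma> i) \<bullet> w (\<sigma> i) > 0" using nz[OF \<sigma>C] by simp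
    ultimately have "w (\<sigma> i) \<bullet> p i < 0" by linarith
    then show ?thesis by (simp add: f_def)
  qed
  moreover have "f k < f (Suc k)" if "Suc k < card C" for k
  proof -
    have "\<not> m dvd (i + int (Suc k)) - i"
      using that zdvd_not_zless[of "int (Suc k)" m] by (simp add: m_def)
    then have "(i + int (Suc k)) mod m \<noteq> i mod m" by (simp add: mod_eq_dvd_iff)
    then have "\<sigma> (i + int (Suc k)) \<noteq> \<sigma> i" using \<sigma> unfolding cyclic_enumeration_def m_def by blast
    then have "w (\<sigma> i) \<bullet> w (\<sigma> (i + int (Suc k))) < 0" using obtuse[OF \<sigma>C \<sigma>C] by metis
    moreover have "p (i + int k) = p (i + int (Suc k)) + w (\<sigma> (i + int (Suc k)))"
      using step[of "i + int (Suc k)"] by (simp add: algebra_simps)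
    ultimately show ?thesis unfolding f_def by (simp add: inner_simps)
  qed
  moreover have "g (Suc k) = g k + l (i + int k) * f k" for k
  proof -
    have "x (i + int (Suc k)) = x (i + int k) + l (i + int k) *\<^sub>R p (i + int k)"
      using x(2)[of "i + int k"] by (simp add: algebra_simps)
    then show ?thesis by (simp add: g_def f_def inner_simps)
  qed
  moreover have "g 0 = 0" "g (card C) = 0" using x(1) by (simp_all add: g_def)
  ultimately have neg: "g k < 0" if "0 < k" "k < card C" for k
    using partial_sums_negative[of g "card C" "\<lambda>k. l (i + int k)" f k] l that by blast
  define k where "k = nat ((j - i) mod m)"
  have k: "int k = (j - i) mod m" using m by (simp add: k_def)
  have "(j - i) mod m \<noteq> 0" using ij unfolding m_def by (metis mod_eq_dvd_iff dvd_eq_mod_eq_0)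
  then have "0 < int k" using m unfolding k by (simp add: order_less_le)
  moreover have "int k < m" using m unfolding k by simp
  moreover have "x (i + int k) = x j"
    by (rule periodic_cong[of x m]) (use x(1) in \<open>simp_all add: m_def k mod_add_right_eq\<close>)
  ultimately show ?thesis using neg[of k] by (simp add: g_def m_def inner_simps)
qed

section \<open>Barycentric coordinates of a full-dimensional simplex\<close>

text \<open>The affine function \<open>y \<mapsto> b c - w c \<bullet> y\<close> is the barycentric coordinate of the vertex \<open>c\<close>. So \<open>w c\<close> is
  an outer normal of the facet opposite to \<open>c\<close>, in the scaling for which the normals add up to zero.\<close>

locale barycentric_frame =
  fixes C :: "'a::euclidean_space set" and w :: "'a \<Rightarrow> 'a" and b :: "'a \<Rightarrow> real"
  assumes indep: "\<not> affine_dependent C" and card: "card C = DIM('a) + 1"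
    and dual: "\<And>c d. c \<in> C \<Longrightarrow> d \<in> C \<Longrightarrow> b c - w c \<bullet> d = (if d = c then 1 else 0)"
begin

definition bary :: "'a \<Rightarrow> 'a \<Rightarrow> real" where
  "bary c y = b c - w c \<bullet> y"

lemma finite_C: "finite C"
  using indep by (rule aff_independent_finite)

lemma card_ge_2: "card C \<ge> 2"
  using card DIM_positive[where 'a = 'a] by linarith

lemma affine_hull_C: "affine hull C = UNIV"
  using affine_independent_span_gt[OF indep] card by simp

lemma bary_affine_combination:
  assumes "sum u C = 1" "c \<in> C"
  shows "bary c (\<Sum>d\<in>C. u d *\<^sub>R d) = u c"
proof -
  have "bary c (\<Sum>d\<in>C. u d *\<^sub>R d) = (\<Sum>d\<in>C. u d * (b c - w c \<bullet> d))"
    using assms(1) unfolding bary_def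
    by (simp add: inner_sum_right right_diff_distrib sum_subtractf flip: sum_distrib_right)
  also have "\<dots> = (\<Sum>d\<in>C. if d = c then u d else 0)"
    using dual[OF assms(2)] by (intro sum.cong) auto
  finally show ?thesis using assms(2) finite_C by simp
qed

lemma bary_sum: "(\<Sum>c\<in>C. bary c y) = 1"
  and bary_combination: "(\<Sum>c\<in>C. bary c y *\<^sub>R c) = y"
proof -
  have "y \<in> affine hull C" by (simp add: affine_hull_C)
  then obtain u where u: "sum u C = 1" "(\<Sum>c\<in>C. u c *\<^sub>R c) = y"
    using affine_hull_finite[OF finite_C] by auto
  then have "bary c y = u c" if "c \<in> C" for c using bary_affine_combination[OF u(1) that] by simp
  then show "(\<Sum>c\<in>C. bary c y) = 1" "(\<Sum>c\<in>C. bary c y *\<^sub>R c) = y" using u by simp_all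
qed

lemma sum_b: "sum b C = 1"
  using bary_sum[of 0] by (simp add: bary_def)

text \<open>The barycentric coordinates add up to the constant function 1, whose gradient vanishes.\<close>

lemma sum_w: "sum w C = 0"
proof -
  have "sum w C \<bullet> y = 0" for y
    using bary_sum[of y] sum_b by (simp add: bary_def sum_subtractf inner_sum_left)
  then show ?thesis using inner_eq_zero_iff by blast
qed

lemma w_nonzero:
  assumes "c \<in> C" shows "w c \<noteq> 0"
proof
  assume 0: "w c = 0"
  have "C - {c} \<noteq> {}" using card_ge_2 finite_C assms by (metis card_Diff_singleton card.empty diff_is_0_eq Suc_1 not_less_eq_eq One_nat_def)
  then obtain d where "d \<in> C" "d \<noteq> c" by blast
  then show False using dual[OF assms \<open>d \<in> C\<close>] dual[OF assms assms] 0 by simp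
qed

lemma mem_hull_iff: "y \<in> convex hull C \<longleftrightarrow> (\<forall>c\<in>C. bary c y \<ge> 0)"
proof
  assume "y \<in> convex hull C"
  then obtain u where "\<forall>c\<in>C. u c \<ge> 0" "sum u C = 1" "(\<Sum>c\<in>C. u c *\<^sub>R c) = y"
    using convex_hull_finite[OF finite_C] by auto
  then show "\<forall>c\<in>C. bary c y \<ge> 0" using bary_affine_combination by metis
next
  assume "\<forall>c\<in>C. bary c y \<ge> 0"
  then show "y \<in> convex hull C"
    unfolding convex_hull_finite[OF finite_C] mem_Collect_eq
    using bary_sum bary_combination by (intro exI[of _ "\<lambda>c. bary c y"]) simp
qed

lemma mem_face_iff:
  assumes "c \<in> C"
  shows "y \<in> convex hull (C - {c}) \<longleftrightarrow> y \<in> convex hull C \<and> bary c y = 0"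
proof
  assume y: "y \<in> convex hull (C - {c})"
  have "convex hull (C - {c}) \<subseteq> {z. w c \<bullet> z = b c}"
  proof (rule hull_minimal)
    show "C - {c} \<subseteq> {z. w c \<bullet> z = b c}"
    proof
      fix d assume "d \<in> C - {c}"
      then show "d \<in> {z. w c \<bullet> z = b c}" using dual[OF assms, of d] by simp
    qed
  qed (rule convex_hyperplane)
  then show "y \<in> convex hull C \<and> bary c y = 0"
    using y hull_mono[of "C - {c}" C convex] by (auto simp: bary_def)
next
  assume y: "y \<in> convex hull C \<and> bary c y = 0"
  have "(\<Sum>d\<in>C - {c}. bary d y) = 1" "(\<Sum>d\<in>C - {c}. bary d y *\<^sub>R d) = y"
    using bary_sum[of y] bary_combination[of y] y assms finite_C
    by (simp_all add: sum.remove[of C c])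
  moreover have "\<forall>d\<in>C - {c}. bary d y \<ge> 0" using y mem_hull_iff by auto
  ultimately show "y \<in> convex hull (C - {c})"
    using convex_hull_finite[of "C - {c}"] finite_C by (auto intro!: exI[of _ "\<lambda>d. bary d y"])
qed

text \<open>Write \<open>q\<close> as a convex combination, with positive weights, of the vertices of its facet. An outer normal \<open>n\<close> at \<open>q\<close> is
  nonpositive on all vectors from \<open>q\<close> to these vertices, hence zero on them. This leaves only the direction of \<open>w c\<close>.\<close>

lemma facet_interior_point:
  assumes c: "c \<in> C" and q0: "bary c q = 0" and q: "\<And>d. d \<in> C \<Longrightarrow> d \<noteq> c \<Longrightarrow> bary d q > 0"
  shows facet_interior_frontier: "q \<in> frontier (convex hull C)"
    and facet_interior_normals: "outer_normals (convex hull C) q = {t *\<^sub>R w c | t. t \<ge> 0}"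
proof -
  have "bary d q \<ge> 0" if "d \<in> C" for d using q0 q[OF that] by (cases "d = c") auto
  then have qS: "q \<in> convex hull C" by (simp add: mem_hull_iff)
  have "q \<notin> interior (convex hull C)"
  proof
    assume "q \<in> interior (convex hull C)"
    then obtain e where e: "e > 0" "cball q e \<subseteq> convex hull C"
      using mem_interior_cball by blast
    define y where "y = q + (e / norm (w c)) *\<^sub>R w c"
    have "y \<in> cball q e" using e(1) w_nonzero[OF c] by (simp add: y_def dist_norm)
    then have "bary c y \<ge> 0" using e(2) c mem_hull_iff by blast
    moreover have "bary c y = - (e / norm (w c)) * (w c \<bullet> w c)"
      using q0 by (simp add: y_def bary_def inner_simps)
    moreover have "(e / norm (w c)) * (w c \<bullet> w c) > 0"
      using e(1) w_nonzero[OF c] by simp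
    ultimately show False by linarith
  qed
  then show "q \<in> frontier (convex hull C)"
    using qS closure_subset by (auto simp: frontier_def)
  show "outer_normals (convex hull C) q = {t *\<^sub>R w c | t. t \<ge> 0}"
  proof (intro subset_antisym subsetI)
    fix n assume "n \<in> {t *\<^sub>R w c | t. t \<ge> 0}"
    then obtain t where t: "n = t *\<^sub>R w c" "t \<ge> 0" by blast
    show "n \<in> outer_normals (convex hull C) q"
      unfolding outer_normals_def
    proof (intro CollectI ballI)
      fix y assume "y \<in> convex hull C"
      then have "bary c y \<ge> 0" using c mem_hull_iff by blast
      then have "w c \<bullet> (y - q) \<le> 0" using q0 by (simp add: bary_def inner_simps)
      then show "n \<bullet> (y - q) \<le> 0" using t by (simp add: mult_nonneg_nonpos)
    qed
  next
    fix n assume n: "n \<in> outer_normals (convex hull C) q"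
    have le: "n \<bullet> (d - q) \<le> 0" if "d \<in> C" for d
      using n hull_inc[OF that, of convex] by (auto simp: outer_normals_def)
    have expand: "n \<bullet> (y - q) = (\<Sum>d\<in>C. bary d y * (n \<bullet> (d - q)))" for y
    proof -
      have "(\<Sum>d\<in>C. bary d y * (n \<bullet> (d - q))) = n \<bullet> (\<Sum>d\<in>C. bary d y *\<^sub>R d) - (\<Sum>d\<in>C. bary d y) * (n \<bullet> q)"
        by (simp add: inner_simps inner_sum_right right_diff_distrib sum_subtractf sum_distrib_right)
      then show ?thesis by (simp add: bary_sum bary_combination inner_simps)
    qed
    have "(\<Sum>d\<in>C. - (bary d q * (n \<bullet> (d - q)))) = 0"
      using expand[of q] by (simp add: sum_negf)
    moreover have "- (bary d q * (n \<bullet> (d - q))) \<ge> 0" if "d \<in> C" for d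
      using le[OF that] \<open>\<And>d. d \<in> C \<Longrightarrow> bary d q \<ge> 0\<close>[OF that] by (simp add: mult_nonneg_nonpos)
    ultimately have zero: "\<forall>d\<in>C. - (bary d q * (n \<bullet> (d - q))) = 0"
      using sum_nonneg_eq_0_iff[OF finite_C, of "\<lambda>d. - (bary d q * (n \<bullet> (d - q)))"] by simp
    have face: "n \<bullet> (d - q) = 0" if "d \<in> C" "d \<noteq> c" for d
      using zero q[OF that] that by auto
    define s where "s = n \<bullet> (c - q)"
    have "n \<bullet> z = (- s *\<^sub>R w c) \<bullet> z" for z
    proof -
      have "n \<bullet> ((q + z) - q) = (\<Sum>d\<in>C. if d = c then bary d (q + z) * s else 0)"
        unfolding expand[of "q + z"] by (intro sum.cong) (auto simp: face s_def)
      also have "\<dots> = bary c (q + z) * s" using c finite_C by simp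
      also have "bary c (q + z) = - (w c \<bullet> z)" using q0 by (simp add: bary_def inner_simps)
      finally show ?thesis by simp
    qed
    then have "n = (- s) *\<^sub>R w c" by (metis vector_eq_rdot inner_commute)
    moreover have "- s \<ge> 0" using le[OF c] by (simp add: s_def)
    ultimately show "n \<in> {t *\<^sub>R w c | t. t \<ge> 0}" by blast
  qed
qed

lemma hyperplane_vectors_in_face_span:
  assumes c: "c \<in> C" and r: "r \<in> C - {c}" and y: "w c \<bullet> y = 0"
  shows "y \<in> span {x - x' | x x'. x \<in> convex hull (C - {c}) \<and> x' \<in> convex hull (C - {c})}"
    (is "_ \<in> span ?D")
proof -
  have "bary c r = 0" using dual[OF c] r by (auto simp: bary_def)
  then have z: "bary c (r + y) = 0" using y by (simp add: bary_def inner_simps)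
  have "y = (\<Sum>d\<in>C. bary d (r + y) *\<^sub>R d) - (\<Sum>d\<in>C. bary d (r + y)) *\<^sub>R r"
    by (simp add: bary_sum bary_combination)
  also have "\<dots> = (\<Sum>d\<in>C. bary d (r + y) *\<^sub>R (d - r))"
    by (simp add: scaleR_diff_right sum_subtractf scaleR_left.sum)
  also have "\<dots> \<in> span ?D"
  proof (rule span_sum)
    fix d assume d: "d \<in> C"
    show "bary d (r + y) *\<^sub>R (d - r) \<in> span ?D"
    proof (cases "d = c")
      case True then show ?thesis using z by (simp add: span_zero)
    next
      case False
      then have "d - r \<in> ?D" using d r by (blast intro: hull_inc)
      then show ?thesis by (intro span_scale span_base)
    qed
  qed
  finally show ?thesis .
qed

text \<open>The conormal of the facet opposite to \<open>c\<close>, at the ridge that it shares with the facet opposite to \<open>d\<close>, is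
  a positive multiple of the orthogonal projection of the inner normal \<open>- w d\<close> to the hyperplane orthogonal to \<open>w c\<close>. The vertex \<open>r\<close> of the ridge serves as an origin,
  and the remaining vertex \<open>d\<close> of the facet determines the orientation.\<close>

lemma inward_conormal_eq:
  assumes c: "c \<in> C" and d: "d \<in> C" and "c \<noteq> d" and r: "r \<in> C - {c, d}"
  defines "e \<equiv> ((w c \<bullet> w d) / (w c \<bullet> w c)) *\<^sub>R w c - w d"
  shows "e \<noteq> 0"
    "inward_conormal (convex hull (C - {c})) (convex hull (C - {c}) \<inter> convex hull (C - {d})) = sgn e"
proof -
  define F where "F = convex hull (C - {c})"
  define G where "G = convex hull (C - {d})"
  let ?D = "{x - y | x y. x \<in> F \<and> y \<in> F}"
  define Q where "Q u \<longleftrightarrow> norm u = 1 \<and> u \<in> span ?D \<and>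
      (\<forall>x\<in>F \<inter> G. \<forall>y\<in>F \<inter> G. u \<bullet> (x - y) = 0) \<and> (\<forall>x\<in>F. \<forall>y\<in>F \<inter> G. u \<bullet> (x - y) \<ge> 0)" for u
  have ec: "e \<bullet> w c = 0" using w_nonzero[OF c] by (simp add: e_def inner_simps inner_commute)
  have Fc: "w c \<bullet> (x - y) = 0" if "x \<in> F" "y \<in> F" for x y
    using that mem_face_iff[OF c] by (simp add: F_def bary_def inner_simps)
  have eF: "e \<bullet> (x - y) = bary d x - bary d y" if "x \<in> F" "y \<in> F" for x y
    using Fc[OF that] by (simp add: e_def bary_def inner_diff_left inner_diff_right[of "w d"])
  have rFG: "r \<in> F \<inter> G" and dF: "d \<in> F" using r d \<open>c \<noteq> d\<close> by (auto simp: F_def G_def intro: hull_inc)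
  have "bary d d = 1" "bary d r = 0" using dual[OF d] d r by (auto simp: bary_def)
  then have "e \<bullet> (d - r) = 1" using eF[OF dF, of r] rFG by simp
  then show e0: "e \<noteq> 0" by auto
  have "e \<in> span ?D"
    unfolding F_def using ec r by (intro hyperplane_vectors_in_face_span[OF c, of r]) (auto simp: inner_commute)
  have G: "bary d y = 0" if "y \<in> F \<inter> G" for y using that mem_face_iff[OF d] by (simp add: G_def)
  have F: "bary d x \<ge> 0" if "x \<in> F" for x using that mem_face_iff[OF c] mem_hull_iff d by (simp add: F_def)
  have Qe: "Q (sgn e)"
    unfolding Q_def
  proof (intro conjI ballI)
    show "norm (sgn e) = 1" using e0 by (simp add: norm_sgn)
    show "sgn e \<in> span ?D" unfolding sgn_div_norm using \<open>e \<in> span ?D\<close> by (rule span_scale)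
    show "sgn e \<bullet> (x - y) = 0" if "x \<in> F \<inter> G" "y \<in> F \<inter> G" for x y
      using eF[of x y] that G by (simp add: sgn_div_norm)
    show "sgn e \<bullet> (x - y) \<ge> 0" if "x \<in> F" "y \<in> F \<inter> G" for x y
      using eF[of x y] that G[of y] F[of x] by (simp add: sgn_div_norm)
  qed
  \<comment> \<open>A vector along the facet that is orthogonal to the ridge and to \<open>d - r\<close> is orthogonal to all vectors along the facet, hence to itself.\<close>
  have null: "z = 0" if z: "z \<in> span ?D" "\<And>x y. x \<in> F \<inter> G \<Longrightarrow> y \<in> F \<inter> G \<Longrightarrow> z \<bullet> (x - y) = 0" "z \<bullet> (d - r) = 0" for z
  proof -
    have vert: "z \<bullet> a = z \<bullet> r" if "a \<in> C - {c}" for a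
    proof (cases "a = d")
      case True then show ?thesis using z(3) by (simp add: inner_simps)
    next
      case False
      then have "a \<in> F \<inter> G" using that by (auto simp: F_def G_def intro: hull_inc)
      then show ?thesis using z(2)[OF _ rFG] by (simp add: inner_simps)
    qed
    have "F \<subseteq> {x. z \<bullet> x = z \<bullet> r}"
      unfolding F_def by (rule hull_minimal) (use vert in \<open>auto simp: convex_hyperplane\<close>)
    then have "z \<bullet> x = z \<bullet> r" if "x \<in> F" for x using that by blast
    then have "\<And>v. v \<in> ?D \<Longrightarrow> orthogonal z v" by (auto simp: orthogonal_def inner_simps)
    then have "orthogonal z z" using z(1) by (rule orthogonal_to_span[rotated]) 
    then show "z = 0" by (simp add: orthogonal_def)
  qed
  have unique: "u = sgn e" if u: "Q u" for u
  proof -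
    have pos: "v \<bullet> (d - r) > 0" if "Q v" for v
    proof -
      have "v \<bullet> (d - r) \<ge> 0" using that dF rFG unfolding Q_def by blast
      moreover have "v \<bullet> (d - r) \<noteq> 0"
        using null[of v] that unfolding Q_def by auto
      ultimately show ?thesis by linarith
    qed
    let ?a = "u \<bullet> (d - r)" and ?a' = "sgn e \<bullet> (d - r)"
    have "?a' *\<^sub>R u - ?a *\<^sub>R sgn e = 0"
    proof (rule null)
      show "?a' *\<^sub>R u - ?a *\<^sub>R sgn e \<in> span ?D"
        using u Qe unfolding Q_def by (intro span_diff span_scale) auto
      show "(?a' *\<^sub>R u - ?a *\<^sub>R sgn e) \<bullet> (x - y) = 0" if "x \<in> F \<inter> G" "y \<in> F \<inter> G" for x y
      proof -
        have "u \<bullet> (x - y) = 0" "sgn e \<bullet> (x - y) = 0" using u Qe that unfolding Q_def by blast+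
        then show ?thesis by (simp add: inner_diff_left)
      qed
      show "(?a' *\<^sub>R u - ?a *\<^sub>R sgn e) \<bullet> (d - r) = 0" by (simp add: inner_diff_left)
    qed
    then have eq: "?a' *\<^sub>R u = ?a *\<^sub>R sgn e" by simp
    have "norm (?a' *\<^sub>R u) = norm (?a *\<^sub>R sgn e)" by (rule arg_cong[OF eq])
    then have "?a' * norm u = ?a * norm (sgn e)"
      unfolding norm_scaleR using pos[OF u] pos[OF Qe] by simp
    then have aa: "?a' = ?a" using u Qe unfolding Q_def by simp
    have "u = sgn e \<or> ?a = 0" using eq unfolding aa scaleR_cancel_left .
    then show ?thesis using pos[OF u] by (metis less_irrefl)
  qed
  have "inward_conormal F (F \<inter> G) = (THE u. Q u)" unfolding inward_conormal_def Q_def ..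
  also have "\<dots> = sgn e" using Qe unique by (rule the_equality)
  finally show "inward_conormal (convex hull (C - {c})) (convex hull (C - {c}) \<inter> convex hull (C - {d})) = sgn e"
    by (simp add: F_def G_def)
qed

text \<open>With \<open>t = w c \<bullet> w d\<close>, the inner product of the two unnormalised conormals is \<open>t\<close> times a factor that is
  nonpositive by Cauchy--Schwarz, so it is positive only if \<open>t < 0\<close>. A segment has no ridges; its two normals are opposite
  because they add up to zero.\<close>

lemma acute_imp_inner_neg:
  assumes acute: "acute_dihedral_angles (convex hull C)" and c: "c \<in> C" and d: "d \<in> C" and "c \<noteq> d"
  shows "w c \<bullet> w d < 0"
proof (cases "C = {c, d}")
  case True
  then have "w c + w d = 0" using sum_w \<open>c \<noteq> d\<close> by simp
  then have "w d = - w c" by (simp add: eq_neg_iff_add_eq_0 add.commute)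
  then show ?thesis using w_nonzero[OF c] by simp
next
  case False
  then obtain r where r: "r \<in> C - {c, d}" using c d by blast
  define F where "F = convex hull (C - {c})"
  define G where "G = convex hull (C - {d})"
  have "F facet_of convex hull C" "G facet_of convex hull C"
    unfolding facet_of_convex_hull_affine_independent[OF indep] F_def G_def using c d \<open>c \<noteq> d\<close> by auto
  moreover have "r \<in> F \<inter> G" using r by (auto simp: F_def G_def intro: hull_inc)
  moreover have "F \<noteq> G"
  proof -
    have "c \<in> G" using c \<open>c \<noteq> d\<close> by (auto simp: G_def intro: hull_inc)
    moreover have "c \<notin> F" unfolding F_def mem_face_iff[OF c] using dual[OF c c] by (simp add: bary_def)
    ultimately show ?thesis by blast
  qed
  ultimately have "dihedral_angle F G < pi / 2" using acute unfolding acute_dihedral_angles_def by blast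
  define e where "e = ((w c \<bullet> w d) / (w c \<bullet> w c)) *\<^sub>R w c - w d"
  define e' where "e' = ((w d \<bullet> w c) / (w d \<bullet> w d)) *\<^sub>R w d - w c"
  have e: "e \<noteq> 0" "inward_conormal F (F \<inter> G) = sgn e"
    using inward_conormal_eq[OF c d \<open>c \<noteq> d\<close> r] unfolding e_def F_def G_def by auto
  have e': "e' \<noteq> 0" "inward_conormal G (F \<inter> G) = sgn e'"
    using inward_conormal_eq[OF d c \<open>c \<noteq> d\<close>[symmetric], of r] r unfolding e'_def F_def G_def
    by (auto simp: Int_commute insert_commute)
  have "arccos (sgn e \<bullet> sgn e') < pi / 2"
    using \<open>dihedral_angle F G < pi / 2\<close> e e' by (simp add: dihedral_angle_def vec_angle_def norm_sgn)
  moreover have "\<bar>sgn e \<bullet> sgn e'\<bar> \<le> 1"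
    using Cauchy_Schwarz_ineq2[of "sgn e" "sgn e'"] e e' by (simp add: norm_sgn)
  ultimately have "sgn e \<bullet> sgn e' > 0"
    using arccos_le_mono[of 0 "sgn e \<bullet> sgn e'"] by (smt (verit) arccos_0)
  then have "e \<bullet> e' > 0" using e(1) e'(1) by (simp add: sgn_div_norm zero_less_mult_iff zero_less_divide_iff)
  define t where "t = w c \<bullet> w d"
  have n: "w c \<bullet> w c > 0" "w d \<bullet> w d > 0" using w_nonzero c d by auto
  have "e \<bullet> e' = t * (t\<^sup>2 / ((w c \<bullet> w c) * (w d \<bullet> w d)) - 1)"
    using n by (simp add: e_def e'_def inner_simps inner_commute[of "w d" "w c"] t_def[symmetric] power2_eq_square field_simps)
  moreover have "t\<^sup>2 / ((w c \<bullet> w c) * (w d \<bullet> w d)) - 1 \<le> 0"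
    using Cauchy_Schwarz_ineq[of "w c" "w d"] n by (simp add: t_def divide_le_eq_1)
  ultimately have "t < 0" using \<open>e \<bullet> e' > 0\<close> by (smt (verit) mult_nonneg_nonpos)
  then show ?thesis by (simp add: t_def)
qed

lemma point_with_prescribed_bary:
  assumes "sum a C = 1"
  obtains y where "\<And>c. c \<in> C \<Longrightarrow> bary c y = a c"
  using that[of "\<Sum>d\<in>C. a d *\<^sub>R d"] bary_affine_combination[OF assms] by blast

end

text \<open>The vector \<open>n\<close> from the affine hull of the other vertices to \<open>c\<close>, perpendicular to that hull and suitably scaled, is
  the gradient of the barycentric coordinate of \<open>c\<close>.\<close>

lemma barycentric_frame_exists:
  fixes C :: "'a::euclidean_space set"
  assumes indep: "\<not> affine_dependent C" and card: "card C = DIM('a) + 1"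
  obtains w b where "barycentric_frame C w b"
proof -
  have fin: "finite C" using indep by (rule aff_independent_finite)
  have "\<exists>w b. \<forall>d\<in>C. b - w \<bullet> d = (if d = c then 1 else 0)" if c: "c \<in> C" for c
  proof -
    define A where "A = affine hull (C - {c})"
    have "card (C - {c}) \<ge> 1" using c fin card DIM_positive[where 'a = 'a] by simp
    then have "C - {c} \<noteq> {}" by force
    then have ne: "A \<noteq> {}" by (simp add: A_def)
    have aff: "affine A" "closed A" "convex A" by (simp_all add: A_def affine_imp_convex)
    have cA: "c \<notin> A" using indep c unfolding A_def affine_dependent_def by blast
    define z where "z = closest_point A c"
    have zA: "z \<in> A" unfolding z_def using aff(2) ne by (rule closest_point_in_set)
    have orth: "(c - z) \<bullet> (d - z) = 0" if "d \<in> A" for d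
    proof -
      \<comment> \<open>Reflecting \<open>d\<close> in \<open>z\<close> turns the inequality for nearest points into an equality.\<close>
      have "2 *\<^sub>R z - d \<in> A"
        using mem_affine[OF aff(1) zA that, of 2 "-1"] by simp
      then have "(c - z) \<bullet> (2 *\<^sub>R z - d - z) \<le> 0" "(c - z) \<bullet> (d - z) \<le> 0"
        using closest_point_dot[OF aff(3,2)] that unfolding z_def by blast+
      then show ?thesis by (simp add: inner_simps)
    qed
    define n where "n = (c - z) /\<^sub>R ((c - z) \<bullet> (c - z))"
    have "c - z \<noteq> 0" using cA zA by auto
    then have "n \<bullet> (c - z) = 1" by (simp add: n_def)
    moreover have "n \<bullet> (d - z) = 0" if "d \<in> C - {c}" for d
      using orth[of d] that by (simp add: n_def A_def hull_inc)
    ultimately have "\<forall>d\<in>C. - (n \<bullet> z) - (- n) \<bullet> d = (if d = c then 1 else 0)"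
      by (auto simp: inner_simps)
    then show ?thesis by blast
  qed
  then have "\<forall>c. \<exists>w b. c \<in> C \<longrightarrow> (\<forall>d\<in>C. b - w \<bullet> d = (if d = c then 1 else 0))" by blast
  then obtain w b where "\<forall>c. c \<in> C \<longrightarrow> (\<forall>d\<in>C. b c - w c \<bullet> d = (if d = c then 1 else 0))"
    by metis
  then have "barycentric_frame C w b" using indep card by unfold_locales auto
  then show thesis by (rule that)
qed

section \<open>The billiard trajectory\<close>

theorem corollary1p2:
  fixes S :: "'a::euclidean_space set"
  assumes "int DIM('a) simplex S"
    and "acute_dihedral_angles S"
  shows "\<exists>q. classical_billiard_trajectory S (DIM('a) + 1) q"
proof -
  obtain C where C: "\<not> affine_dependent C" "card C = DIM('a) + 1" and S: "S = convex hull C"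
    using assms(1) unfolding simplex by auto
  obtain w b where "barycentric_frame C w b" using barycentric_frame_exists[OF C] .
  then interpret barycentric_frame C w b .
  have obtuse: "w c \<bullet> w d < 0" if "c \<in> C" "d \<in> C" "c \<noteq> d" for c d
    using acute_imp_inner_neg that assms(2) unfolding S by blast
  obtain \<sigma> p l R where \<sigma>: "cyclic_enumeration C \<sigma>"
    and path: "centred_path w (int (card C)) \<sigma> p l R" and l: "\<And>i. l i > 0" and R: "\<And>i. norm (p i) = R"
    using balanced_closed_path[OF finite_C card_ge_2 sum_w obtuse] by blast
  define m where "m = int (card C)"
  have m: "m \<ge> 2" "m > 0" using card_ge_2 by (simp_all add: m_def)
  have perp: "p (i + m) = p i" and perl: "l (i + m) = l i" and step: "p (i - 1) - p i = w (\<sigma> i)"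
    and sum0: "(\<Sum>i\<in>{0..<m}. l i *\<^sub>R p i) = 0" for i
    using path unfolding centred_path_def m_def by blast+
  have \<sigma>C: "\<sigma> i \<in> C" for i using \<sigma> unfolding cyclic_enumeration_def by blast
  have \<sigma>cong: "\<sigma> i = \<sigma> j \<longleftrightarrow> i mod m = j mod m" for i j
    using \<sigma> unfolding cyclic_enumeration_def m_def by blast
  have bij: "bij_betw \<sigma> {0..<m} C"
    using cyclic_enumeration_bij[OF \<sigma>] m by (simp add: m_def)
  have per: "l (i + m) *\<^sub>R p (i + m) = l i *\<^sub>R p i" for i using perp perl by simp
  obtain x where perx: "\<And>i. x (i + m) = x i" and x: "\<And>i. x (i + 1) - x i = l i *\<^sub>R p i"
    using periodic_antidifference[OF m(2) per sum0] by blast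
  have peak: "w (\<sigma> i) \<bullet> x j < w (\<sigma> i) \<bullet> x i" if "i mod m \<noteq> j mod m" for i j
  proof (rule vertex_is_unique_maximum[where C = C and \<sigma> = \<sigma> and w = w and p = p and l = l and R = R])
    show "x (k + int (card C)) = x k" for k using perx[of k] by (simp add: m_def)
    show "i mod int (card C) \<noteq> j mod int (card C)" using that by (simp add: m_def)
  qed (fact card_ge_2 \<sigma> obtuse w_nonzero step l R x)+
  define T where "T = (\<Sum>i\<in>{0..<m}. w (\<sigma> i) \<bullet> x i)"
  \<comment> \<open>The hyperplanes orthogonal to \<open>w (\<sigma> i)\<close> through \<open>x i\<close> bound a homothetic copy of \<open>S\<close> with ratio \<open>T\<close>, which is positive because the heights of \<open>x 0\<close> add up to zero.\<close>
  have "(\<Sum>i\<in>{0..<m}. w (\<sigma> i) \<bullet> x 0) < T"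
    unfolding T_def
  proof (rule sum_strict_mono_ex1)
    have "w (\<sigma> i) \<bullet> x 0 \<le> w (\<sigma> i) \<bullet> x i" if "i \<in> {0..<m}" for i
      using peak[of i 0] that by (cases "i = 0") auto
    then show "\<forall>i\<in>{0..<m}. w (\<sigma> i) \<bullet> x 0 \<le> w (\<sigma> i) \<bullet> x i" by blast
    show "\<exists>i\<in>{0..<m}. w (\<sigma> i) \<bullet> x 0 < w (\<sigma> i) \<bullet> x i"
      using peak[of 1 0] m by (intro bexI[of _ 1]) auto
  qed simp
  moreover have "(\<Sum>i\<in>{0..<m}. w (\<sigma> i) \<bullet> x 0) = 0"
    using sum.reindex_bij_betw[OF bij, of w] sum_w by (simp flip: inner_sum_left)
  ultimately have T: "T > 0" by simp
  \<comment> \<open>A right inverse of \<open>\<sigma>\<close>, which re-indexes the bounce points by the vertices opposite to their facets.\<close>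
  define \<iota> where "\<iota> c = (SOME i. \<sigma> i = c)" for c
  have \<iota>: "x (\<iota> (\<sigma> i)) = x i" for i
  proof -
    have "\<sigma> (\<iota> (\<sigma> i)) = \<sigma> i" unfolding \<iota>_def by (rule someI) (rule refl)
    then show ?thesis using periodic_cong[of x m, OF perx] \<sigma>cong by blast
  qed
  have "(\<Sum>c\<in>C. (w c \<bullet> x (\<iota> c)) / T) = (\<Sum>i\<in>{0..<m}. (w (\<sigma> i) \<bullet> x (\<iota> (\<sigma> i))) / T)"
    by (rule sum.reindex_bij_betw[OF bij, symmetric])
  also have "\<dots> = 1" using T by (simp add: \<iota> T_def flip: sum_divide_distrib)
  finally obtain y where y: "\<And>c. c \<in> C \<Longrightarrow> bary c y = (w c \<bullet> x (\<iota> c)) / T"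
    using point_with_prescribed_bary by blast
  \<comment> \<open>The homothety that maps the copy to \<open>S\<close>: the choice of \<open>y\<close> puts each \<open>q i\<close> on the facet opposite to \<open>\<sigma> i\<close>.\<close>
  define q where "q i = y + (1 / T) *\<^sub>R x i" for i
  have baryq: "bary (\<sigma> i) (q j) = (w (\<sigma> i) \<bullet> x i - w (\<sigma> i) \<bullet> x j) / T" for i j
    using y[OF \<sigma>C, of i] \<iota>[of i] by (simp add: q_def bary_def inner_simps diff_divide_distrib)
  have on: "bary (\<sigma> i) (q i) = 0" for i by (simp add: baryq)
  have off: "bary (\<sigma> i) (q j) > 0" if "i mod m \<noteq> j mod m" for i j
    using peak[OF that] T by (simp add: baryq)
  have off': "bary d (q i) > 0" if "d \<in> C" "d \<noteq> \<sigma> i" for d i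
  proof -
    obtain j where "d = \<sigma> j" using \<open>d \<in> C\<close> \<sigma> unfolding cyclic_enumeration_def by blast
    then show ?thesis using off[of j i] \<sigma>cong that(2) by auto
  qed
  have frontier: "q i \<in> frontier S" and normals: "outer_normals S (q i) = {t *\<^sub>R w (\<sigma> i) | t. t \<ge> 0}" for i
    using facet_interior_point[OF \<sigma>C on off'] unfolding S by auto
  have "R \<ge> 0" using R[of 0] norm_ge_zero by metis
  moreover have "R \<noteq> 0"
  proof
    assume "R = 0"
    then have "p i = 0" for i using R by simp
    then show False using step[of 0] w_nonzero[OF \<sigma>C, of 0] by simp
  qed
  ultimately have "R > 0" by simp
  have dir: "sgn (q (i + 1) - q i) = (1 / R) *\<^sub>R p i" for i
  proof -
    have "q (i + 1) - q i = (l i / T) *\<^sub>R p i"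
      using x[of i] by (simp add: q_def flip: scaleR_diff_right)
    moreover have "sgn (p i) = (1 / R) *\<^sub>R p i" using R[of i] by (simp add: sgn_div_norm divide_inverse)
    ultimately show ?thesis using l[of i] T by (simp add: sgn_scaleR)
  qed
  have turn: "sgn (q i - q (i - 1)) - sgn (q (i + 1) - q i) = (1 / R) *\<^sub>R w (\<sigma> i)" for i
    using dir[of i] dir[of "i - 1"] step[of i] by (simp flip: scaleR_diff_right)
  have segment: "q i \<notin> closed_segment (q (i - 1)) (q (i + 1))" for i
  proof
    have "i mod m \<noteq> (i - 1) mod m" "i mod m \<noteq> (i + 1) mod m"
      using mod_consecutive_neq[OF m(1), of i] by auto
    then have "q (i - 1) \<in> {z. w (\<sigma> i) \<bullet> z < b (\<sigma> i)}" "q (i + 1) \<in> {z. w (\<sigma> i) \<bullet> z < b (\<sigma> i)}"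
      using off unfolding bary_def by force+
    then have sub: "closed_segment (q (i - 1)) (q (i + 1)) \<subseteq> {z. w (\<sigma> i) \<bullet> z < b (\<sigma> i)}"
      by (intro closed_segment_subset convex_halfspace_lt)
    assume "q i \<in> closed_segment (q (i - 1)) (q (i + 1))"
    then show False using sub on[of i] by (auto simp: bary_def)
  qed
  have "classical_billiard_trajectory S (DIM('a) + 1) q"
    unfolding classical_billiard_trajectory_def generalized_billiard_trajectory_def Let_def turn C(2)[symmetric]
  proof (intro conjI allI)
    show "card C \<ge> 2" by (rule card_ge_2)
    show "q (i + int (card C)) = q i" for i using perx[of i] by (simp add: q_def m_def)
    show "q i \<in> frontier S" for i by (rule frontier)
    show "q i \<notin> closed_segment (q (i - 1)) (q (i + 1))" for i by (rule segment)
    show "(1 / R) *\<^sub>R w (\<sigma> i) \<noteq> 0" for i using \<open>R > 0\<close> w_nonzero[OF \<sigma>C] by simp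
    show "(1 / R) *\<^sub>R w (\<sigma> i) \<in> outer_normals S (q i)" for i
      unfolding normals using \<open>R > 0\<close> by (intro CollectI exI[of _ "1 / R"]) simp
    show "smooth_point S (q i)" for i
      unfolding smooth_point_def using frontier normals w_nonzero[OF \<sigma>C] by blast
  qed
  then show ?thesis by blast
qed

end
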